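(* For all $(a,c)\in\mathbb R\times\mathbb R$, the following identity of meromorphic functions of $s\in\mathbb C$ holds: $$\zeta_*(1-s,a,c)=(2\pi)^{-s}\Gamma(s)\Big\{e^{\frac{\pi i s}{2}}e^{-2\pi i ac}\zeta_*(s,1-c,a)+e^{-\frac{\pi i s}{2}}e^{2\pi i c(1-a)}\zeta_*(s,c,1-a)\Big\}.$$
   Context: Let $\delta_{\mathbb Z}(x)=1$ if $x\in\mathbb Z$ and $0$ otherwise. For real $a,c$ and $s\in\mathbb C\setminus\{0,1\}$ define $$\Lambda^{+}(s,a,c):=2\int_1^\infty\Big(\sum_{n\in\mathbb Z,\,n\ne -c}e^{2\pi i a n}e^{-\pi(n+c)^2x^2}\Big)x^{s-1}dx+2\int_1^\infty\Big(\sum_{n\in\mathbb Z,\,n\neq a}e^{2\pi i c(n-a)}e^{-\pi(n-a)^2y^2}\Big)y^{-s}dy+\frac{2\delta_{\mathbb Z}(a)}{s-1}-\frac{2\delta_{\mathbb Z}(c)e^{-2\pi i ac}}{s},$$ $$\Lambda^{-}(s,a,c):=2\int_1^\infty\Big(\sum_{n\in\mathbb Z}e^{2\pi i a n}(n+c)e^{-\pi(n+c)^2x^2}\Big)x^{s}dx-2i\int_1^\infty\Big(\sum_{n\in\mathbb Z}e^{2\pi i c(n-a)}(n-a)e^{-\pi(n-a)^2y^2}\Big)y^{1-s}dy,$$ and the extended Lerch zeta function $\zeta_*(s,a,c):=\frac12\big(\frac{\pi^{s/2}}{\Gamma(s/2)}\Lambda^{+}(s,a,c)+\frac{\pi^{(s+1)/2}}{\Gamma(\frac{s+1}{2})}\Lambda^{-}(s,a,c)\big)$,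 a meromorphic function of $s$ (removable points filled in by continuation). For $\Re(s)>1$ it equals $\sum_{n+c>0}e^{2\pi i n a}(n+c)^{-s}$. *)

theory Defs
  imports "HOL-Complex_Analysis.Complex_Analysis"
begin

definition delta_int :: "real \<Rightarrow> complex" where
  "delta_int x = (if x \<in> \<int> then 1 else 0)"

text \<open>At \<open>s = 0\<close> and \<open>s = 1\<close> the value of \<open>Lambda_plus\<close> is an artefact of
  \<open>x / 0 = 0\<close>; it never matters, since \<open>zeta_star\<close> below only uses punctured
  neighbourhoods.\<close>

definition Lambda_plus :: "complex \<Rightarrow> real \<Rightarrow> real \<Rightarrow> complex" where
  "Lambda_plus s a c =
     2 * integral {1..} (\<lambda>x::real.
           (\<Sum>\<^sub>\<infinity>n\<in>{n::int. of_int n \<noteq> - c}.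
              exp (2 * of_real pi * \<i> * of_real a * of_int n) *
              of_real (exp (- pi * (of_int n + c)\<^sup>2 * x\<^sup>2))) *
           of_real x powr (s - 1))
   + 2 * integral {1..} (\<lambda>y::real.
           (\<Sum>\<^sub>\<infinity>n\<in>{n::int. of_int n \<noteq> a}.
              exp (2 * of_real pi * \<i> * of_real c * of_real (of_int n - a)) *
              of_real (exp (- pi * (of_int n - a)\<^sup>2 * y\<^sup>2))) *
           of_real y powr (- s))
   + 2 * delta_int a / (s - 1)
   - 2 * delta_int c * exp (- 2 * of_real pi * \<i> * of_real a * of_real c) / s"

definition Lambda_minus :: "complex \<Rightarrow> real \<Rightarrow> real \<Rightarrow> complex" where
  "Lambda_minus s a c =
     2 * integral {1..} (\<lambda>x::real.
           (\<Sum>\<^sub>\<infinity>n\<in>(UNIV::int set).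
              exp (2 * of_real pi * \<i> * of_real a * of_int n) *
              of_real ((of_int n + c) * exp (- pi * (of_int n + c)\<^sup>2 * x\<^sup>2))) *
           of_real x powr s)
   - 2 * \<i> * integral {1..} (\<lambda>y::real.
           (\<Sum>\<^sub>\<infinity>n\<in>(UNIV::int set).
              exp (2 * of_real pi * \<i> * of_real c * of_real (of_int n - a)) *
              of_real ((of_int n - a) * exp (- pi * (of_int n - a)\<^sup>2 * y\<^sup>2))) *
           of_real y powr (1 - s))"

text \<open>The extended Lerch zeta function. \<open>remove_sings\<close> fills in the removable points
  by their limits; at a genuine pole the value is 0 by convention.\<close>

definition zeta_star :: "complex \<Rightarrow> real \<Rightarrow> real \<Rightarrow> complex" where
  "zeta_star s a c = remove_sings (\<lambda>z.
     1 / 2 * (of_real pi powr (z / 2) / Gamma (z / 2) * Lambda_plus z a c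
            + of_real pi powr ((z + 1) / 2) / Gamma ((z + 1) / 2) * Lambda_minus z a c)) s"

text \<open>Identity of meromorphic functions on the complex plane: both sides are meromorphic, and
  they agree everywhere once removable singularities are filled in. As \<open>remove_sings\<close> is 0
  at poles, the two sides then also have the same poles with the same principal parts.\<close>

definition meromorphic_identity :: "(complex \<Rightarrow> complex) \<Rightarrow> (complex \<Rightarrow> complex) \<Rightarrow> bool" where
  "meromorphic_identity f g \<longleftrightarrow>
     f meromorphic_on UNIV \<and> g meromorphic_on UNIV \<and> remove_sings f = remove_sings g"

end

theory Submission imports Defs begin

text \<open>The two integrals defining \<open>\<Lambda>\<^sup>\<plusminus>(s, a, c)\<close> are truncated Mellin transforms of theta
  series attached to \<open>(a, c)\<close> and to \<open>(c, -a)\<close>, and \<open>s \<mapsto> 1 - s\<close> exchanges their exponents. Hence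
  \<open>\<Lambda>\<^sup>\<plusminus>(1 - s, a, c)\<close> is, up to an explicit constant, \<open>\<Lambda>\<^sup>\<plusminus>(s, 1 - c, a)\<close>; this needs only
  reindexing of the theta series, not Poisson summation. By parity and quasi-periodicity, passing
  from \<open>(1 - c, a)\<close> to \<open>(c, 1 - a)\<close> multiplies \<open>\<Lambda>\<^sup>\<plusminus>\<close> by \<open>\<plusminus>e\<^bsup>-2\<pi>ic\<^esup>\<close>, so the bracket in the theorem
  separates into a cosine multiple of \<open>\<Lambda>\<^sup>+\<close> and a sine multiple of \<open>\<Lambda>\<^sup>-\<close>, and the Gamma factors
  match by Legendre duplication and Euler reflection. Meromorphy holds because the theta series
  decay rapidly, which makes the truncated Mellin transforms entire.\<close>

section \<open>Truncated Mellin transforms\<close>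

text \<open>A single term of the exponential series is at most the whole sum, all terms being
  nonnegative. This trades polynomial factors for exponentials in the theta estimates.\<close>

lemma power_le_fact_mult_exp:
  fixes x :: real
  assumes "0 \<le> x"
  shows "x ^ k \<le> fact k * exp x"
proof -
  have sm: "summable (\<lambda>n. inverse (fact n) * x ^ n)"
    using summable_exp_generic[of x] by (simp add: divide_inverse mult.commute)
  have "(\<Sum>n\<in>{k}. inverse (fact n) * x ^ n) \<le> (\<Sum>n. inverse (fact n) * x ^ n)"
    using assms by (intro sum_le_suminf sm) auto
  also have "\<dots> = exp x"
    by (simp add: exp_def scaleR_conv_of_real)
  finally show ?thesis by (simp add: field_simps)
qed

lemma summable_on_exp_minus_abs_int: "(\<lambda>n::int. exp (- \<bar>real_of_int n\<bar>)) summable_on UNIV"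
proof -
  have nat: "(\<lambda>n::nat. exp (- real n)) summable_on UNIV"
  proof (rule summable_nonneg_imp_summable_on)
    have "summable (\<lambda>n. exp (-1 :: real) ^ n)"
      by (rule summable_geometric) simp
    thus "summable (\<lambda>n. exp (- real n))"
      by (simp flip: exp_of_nat_mult)
  qed auto
  have pos: "(\<lambda>n::int. exp (- \<bar>real_of_int n\<bar>)) summable_on range int"
    using nat by (subst summable_on_reindex) (auto simp: o_def)
  have neg: "(\<lambda>n::int. exp (- \<bar>real_of_int n\<bar>)) summable_on range (\<lambda>n. - int n)"
    using nat by (subst summable_on_reindex) (auto simp: o_def inj_def)
  have "(\<lambda>n::int. exp (- \<bar>real_of_int n\<bar>)) summable_on (range int \<union> (range (\<lambda>n. - int n) - range int))"
    by (intro summable_on_Un_disjoint pos summable_on_subset[OF neg]) auto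
  moreover have "range int \<union> (range (\<lambda>n. - int n) - range int) = UNIV"
    by (auto intro: int_cases2)
  ultimately show ?thesis by simp
qed

text \<open>A translate of the integers is discrete, so its nonzero points keep a positive distance
  from 0. The gap \<open>d\<close> supplies a Gaussian decay rate common to all theta terms.\<close>

lemma int_translate_gap:
  fixes c :: real
  obtains d where "0 < d" "\<And>n::int. of_int n \<noteq> - c \<Longrightarrow> d \<le> \<bar>of_int n + c\<bar>"
proof -
  \<comment> \<open>For non-integral \<open>c\<close> this is the distance from \<open>c\<close> to
    the nearest integer; for integral \<open>c\<close> the nonzero points have modulus at least
    1.\<close>
  define d where "d = (if c \<in> \<int> then 1 else min (frac c) (1 - frac c))"
  have "0 < d"
    by (auto simp: d_def frac_lt_1 frac_gt_0_iff)
  moreover have "d \<le> \<bar>of_int n + c\<bar>" if "of_int n \<noteq> - c" for n :: int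
  proof (cases "c \<in> \<int>")
    case True
    then obtain m where "c = of_int m" by (auto elim: Ints_cases)
    with that have "n + m \<noteq> 0" by linarith
    hence "1 \<le> \<bar>n + m\<bar>" by linarith
    hence "(1::real) \<le> \<bar>of_int (n + m)\<bar>" by linarith
    with \<open>c = of_int m\<close> True show ?thesis by (simp add: d_def)
  next
    case False
    have eq: "of_int n + c = of_int (n + \<lfloor>c\<rfloor>) + frac c" by (simp add: frac_def)
    consider "0 \<le> n + \<lfloor>c\<rfloor>" | "n + \<lfloor>c\<rfloor> \<le> -1" by linarith
    thus ?thesis
    proof cases
      case 1
      hence "(0::real) \<le> of_int (n + \<lfloor>c\<rfloor>)" by linarith
      with eq False frac_ge_0[of c] show ?thesis by (simp add: d_def)
    next
      case 2
      hence "of_int (n + \<lfloor>c\<rfloor>) \<le> (-1::real)" by linarith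
      with eq False frac_lt_1[of c] show ?thesis by (simp add: d_def)
    qed
  qed
  ultimately show ?thesis by (rule that)
qed

text \<open>The exponent is \<open>s\<close> rather than the customary \<open>s - 1\<close>; shifts
  are left to the places of use.\<close>

definition mellin_tail :: "(real \<Rightarrow> complex) \<Rightarrow> complex \<Rightarrow> complex" where
  "mellin_tail f s = integral {1..} (\<lambda>x. f x * of_real x powr s)"

lemma mellin_tail_cmult: "mellin_tail (\<lambda>x. k * f x) s = k * mellin_tail f s"
  by (simp add: mellin_tail_def mult.assoc)

text \<open>Integrals over bounded intervals are holomorphic by differentiation under the integral
  sign, and the rapid decay makes them converge locally uniformly.\<close>

lemma mellin_tail_holomorphic:
  assumes cont: "continuous_on {1..} f"
    and decay: "\<And>k::nat. \<exists>C. \<forall>x\<ge>1. norm (f x) * x ^ k \<le> C"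
  shows "mellin_tail f holomorphic_on UNIV"
proof (rule holomorphic_uniform_sequence)
  let ?g = "\<lambda>s x. f x * of_real x powr s"
  have contg: "continuous_on S (?g s)" if "S \<subseteq> {1..}" for S s
    using that by (intro continuous_intros continuous_on_subset[OF cont])
                  (auto simp: complex_nonpos_Reals_iff)
  show "(\<lambda>s. integral {1..1 + real n} (?g s)) holomorphic_on UNIV" for n
    unfolding cbox_interval[symmetric]
  proof (rule leibniz_rule_holomorphic)
    fix s :: complex and t :: real assume "t \<in> cbox 1 (1 + real n)"
    hence t: "1 \<le> t" by simp
    show "((\<lambda>s. ?g s t) has_field_derivative f t * (of_real t powr s * Ln (of_real t)))
            (at s within UNIV)"
      using t by (auto intro!: derivative_eq_intros)
  next
    show "?g s integrable_on cbox 1 (1 + real n)" for s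
      by (intro integrable_continuous contg) auto
  next
    have "continuous_on (UNIV \<times> cbox 1 (1 + real n)) (\<lambda>p. f (snd p))"
      by (rule continuous_on_compose2[OF cont]) (auto intro: continuous_intros)
    thus "continuous_on (UNIV \<times> cbox 1 (1 + real n))
            (\<lambda>(s, t). f t * (of_real t powr s * Ln (of_real t)))"
      unfolding case_prod_unfold
      by (intro continuous_intros) (auto simp: complex_nonpos_Reals_iff)
  qed auto
  show "\<exists>d. 0 < d \<and> cball z d \<subseteq> UNIV \<and>
          uniform_limit (cball z d) (\<lambda>n s. integral {1..1 + real n} (?g s)) (mellin_tail f) sequentially"
    for z
  proof (intro exI conjI)
    \<comment> \<open>Real parts on the unit ball around \<open>z\<close> are at most
      \<open>k\<close>, so decay of order \<open>k + 2\<close> leaves the majorant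
      \<open>C / x^2\<close>, whose integral from \<open>N\<close> on is
      \<open>C / N\<close>.\<close>
    obtain k :: nat where k: "\<bar>Re z\<bar> + 1 \<le> real k" using real_arch_simple by blast
    obtain C where C: "norm (f x) * x ^ (k + 2) \<le> C" if "x \<ge> 1" for x
      using decay[of "k + 2"] by blast
    have bound: "norm (?g s x) \<le> C * (1 / x ^ 2)" if s: "s \<in> cball z 1" and x: "1 \<le> x" for s x
    proof -
      have "\<bar>Re (z - s)\<bar> \<le> 1" using s abs_Re_le_cmod[of "z - s"] by (auto simp: dist_norm)
      hence "Re s \<le> real k" using k by auto
      hence "x powr Re s \<le> x ^ k" using x by (simp flip: powr_realpow add: powr_mono)
      hence "norm (?g s x) \<le> norm (f x) * x ^ k"
        using x by (simp add: norm_mult norm_powr_real_powr mult_left_mono)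
      also have "\<dots> = norm (f x) * x ^ (k + 2) * (1 / x ^ 2)"
        using x by (simp add: power_add power2_eq_square)
      also have "\<dots> \<le> C * (1 / x ^ 2)" using C[OF x] x by (intro mult_right_mono) auto
      finally show ?thesis .
    qed
    have inv: "((\<lambda>x. C * (1 / x ^ 2)) has_integral C * (1 / N)) {N..}" if "1 \<le> N" for N :: real
      using has_integral_inverse_power_to_inf[of 2 N] that by (intro has_integral_mult_right) simp
    have int: "?g s integrable_on {N..}" if "s \<in> cball z 1" "1 \<le> N" for s N
    proof (rule measurable_bounded_by_integrable_imp_integrable)
      show "?g s \<in> borel_measurable (lebesgue_on {N..})"
        using that by (intro continuous_imp_measurable_on_sets_lebesgue contg) auto
      show "(\<lambda>x. C * (1 / x ^ 2)) integrable_on {N..}" using inv[OF that(2)] by blast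
    qed (use that bound in auto)
    have tail: "norm (mellin_tail f s - integral {1..N} (?g s)) \<le> C * (1 / N)"
      if s: "s \<in> cball z 1" and N: "1 \<le> N" for s N
    proof -
      have "integral ({1..N} \<union> {N..}) (?g s) = integral {1..N} (?g s) + integral {N..} (?g s)"
      proof (rule integral_Un)
        show "?g s integrable_on {1..N}"
          by (intro integrable_continuous_interval contg) auto
        have "{1..N} \<inter> {N..} = {N}" using N by auto
        thus "negligible ({1..N} \<inter> {N..})" by simp
      qed (rule int[OF s N])
      moreover have "{1..N} \<union> {N..} = {1..}" using N by auto
      ultimately have "mellin_tail f s - integral {1..N} (?g s) = integral {N..} (?g s)"
        by (simp add: mellin_tail_def)
      also have "norm \<dots> \<le> integral {N..} (\<lambda>x. C * (1 / x ^ 2))"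
        using inv[OF N] N by (intro integral_norm_bound_integral int s bound) auto
      also have "\<dots> = C * (1 / N)" using inv[OF N] by (rule integral_unique)
      finally show ?thesis .
    qed
    show "uniform_limit (cball z 1) (\<lambda>n s. integral {1..1 + real n} (?g s)) (mellin_tail f) sequentially"
    proof (rule uniform_limitI)
      fix e :: real assume "0 < e"
      have "(\<lambda>n. C * (1 / (1 + real n))) \<longlonglongrightarrow> C * 0"
        by (intro tendsto_mult_left) (use LIMSEQ_Suc[OF lim_inverse_n'] in \<open>simp add: divide_simps\<close>)
      hence "\<forall>\<^sub>F n in sequentially. C * (1 / (1 + real n)) < e"
        using \<open>0 < e\<close> by (intro order_tendstoD(2)[where y = "C * 0"]) auto
      thus "\<forall>\<^sub>F n in sequentially. \<forall>s\<in>cball z 1.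
              dist (integral {1..1 + real n} (?g s)) (mellin_tail f s) < e"
      proof eventually_elim
        case (elim n)
        show ?case using tail[of _ "1 + real n"] elim by (force simp: dist_norm norm_minus_commute)
      qed
    qed
  qed auto
qed auto

section \<open>Theta series\<close>

text \<open>The term with \<open>n = -c\<close> is constant in \<open>x\<close>: for
  \<open>k = 0\<close> it would spoil the decay, for \<open>k > 0\<close> it is zero. One index set
  thus serves both cases.\<close>

definition theta :: "nat \<Rightarrow> real \<Rightarrow> real \<Rightarrow> real \<Rightarrow> complex" where
  "theta k a c x = (\<Sum>\<^sub>\<infinity>n\<in>{n::int. of_int n \<noteq> - c}.
     cis (2 * pi * a * of_int n) *
     of_real ((of_int n + c) ^ k * exp (- pi * (of_int n + c)\<^sup>2 * x\<^sup>2)))"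

text \<open>With \<open>m = |n + c|\<close>, split \<open>pi\<close> as \<open>1 + (pi - 1)\<close>.
  The part 1 gives the decay in \<open>x\<close>; the part \<open>pi - 1\<close>, at least 2,
  absorbs the power of \<open>m\<close> and gives summability in \<open>n\<close>.\<close>

lemma theta_term_bound:
  fixes c d n x :: real
  assumes "0 < d" "d \<le> \<bar>n + c\<bar>" "1 \<le> x"
  shows "\<bar>(n + c) ^ k * exp (- pi * (n + c)\<^sup>2 * x\<^sup>2)\<bar>
           \<le> fact k * exp (1 + \<bar>c\<bar>) * exp (- d\<^sup>2 * x\<^sup>2) * exp (- \<bar>n\<bar>)"
proof -
  define m where "m = \<bar>n + c\<bar>"
  have x2: "1 \<le> x\<^sup>2" using assms by simp
  have dm: "d\<^sup>2 \<le> m\<^sup>2" unfolding m_def using assms by (intro power_mono) auto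
  have "2 \<le> pi - 1" using pi_gt3 by simp
  hence "2 * m\<^sup>2 \<le> (pi - 1) * (m\<^sup>2 * x\<^sup>2)"
    using x2 mult_left_mono[OF x2, of "m\<^sup>2"] by (intro mult_mono) auto
  moreover have "d\<^sup>2 * x\<^sup>2 \<le> m\<^sup>2 * x\<^sup>2" using dm by (intro mult_right_mono) auto
  \<comment> \<open>One \<open>m\<close> pays for \<open>m ^ k\<close> by way of
    \<open>exp m\<close>, the other for the factor \<open>exp (- |n|)\<close>.\<close>
  moreover have "2 * m \<le> 1 + 2 * m\<^sup>2"
    using zero_le_power2[of "m - 1/2"] zero_le_power2[of m] by (simp add: power2_eq_square algebra_simps)
  moreover have "\<bar>n\<bar> \<le> \<bar>c\<bar> + m" by (simp add: m_def)
  moreover have "(pi - 1) * (m\<^sup>2 * x\<^sup>2) = pi * m\<^sup>2 * x\<^sup>2 - m\<^sup>2 * x\<^sup>2"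
    by (simp add: algebra_simps)
  ultimately have "m - pi * m\<^sup>2 * x\<^sup>2 \<le> 1 + \<bar>c\<bar> - d\<^sup>2 * x\<^sup>2 - \<bar>n\<bar>"
    by linarith
  hence "exp (m - pi * m\<^sup>2 * x\<^sup>2) \<le> exp (1 + \<bar>c\<bar> - d\<^sup>2 * x\<^sup>2 - \<bar>n\<bar>)" by simp
  hence *: "exp m * exp (- pi * m\<^sup>2 * x\<^sup>2) \<le> exp (1 + \<bar>c\<bar>) * exp (- d\<^sup>2 * x\<^sup>2) * exp (- \<bar>n\<bar>)"
    by (simp flip: exp_add)
  have "\<bar>(n + c) ^ k * exp (- pi * (n + c)\<^sup>2 * x\<^sup>2)\<bar> = m ^ k * exp (- pi * m\<^sup>2 * x\<^sup>2)"
    by (simp add: m_def abs_mult power_abs)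
  also have "\<dots> \<le> fact k * exp m * exp (- pi * m\<^sup>2 * x\<^sup>2)"
    by (intro mult_right_mono power_le_fact_mult_exp) (auto simp: m_def)
  also have "\<dots> \<le> fact k * (exp (1 + \<bar>c\<bar>) * exp (- d\<^sup>2 * x\<^sup>2) * exp (- \<bar>n\<bar>))"
    unfolding mult.assoc using * by (intro mult_left_mono) (auto simp: mult.assoc)
  finally show ?thesis by (simp add: mult_ac)
qed

lemma continuous_on_theta: "continuous_on {1..} (theta k a c)"
proof -
  obtain d where d: "0 < d" "\<And>n::int. of_int n \<noteq> - c \<Longrightarrow> d \<le> \<bar>of_int n + c\<bar>"
    using int_translate_gap[of c] by blast
  define M where "M = (\<lambda>n::int. fact k * exp (1 + \<bar>c\<bar>) * exp (- \<bar>real_of_int n\<bar>))"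
  let ?N = "{n::int. of_int n \<noteq> - c}"
  let ?t = "\<lambda>n x. cis (2 * pi * a * real_of_int n) *
     of_real ((of_int n + c) ^ k * exp (- pi * (of_int n + c)\<^sup>2 * x\<^sup>2))"
  have "uniform_limit {1..} (\<lambda>X x. \<Sum>n\<in>X. ?t n x) (\<lambda>x. \<Sum>\<^sub>\<infinity>n\<in>?N. ?t n x) (finite_subsets_at_top ?N)"
  proof (rule Weierstrass_m_test_general)
    fix n and x :: real assume "n \<in> ?N" "x \<in> {1..}"
    hence "norm (?t n x) \<le> fact k * exp (1 + \<bar>c\<bar>) * exp (- d\<^sup>2 * x\<^sup>2) * exp (- \<bar>real_of_int n\<bar>)"
      using theta_term_bound[OF d(1) d(2)[of n], of x k] by (simp add: norm_mult del: of_real_mult)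
    also have "\<dots> \<le> fact k * exp (1 + \<bar>c\<bar>) * 1 * exp (- \<bar>real_of_int n\<bar>)"
      by (intro mult_mono) auto
    finally show "norm (?t n x) \<le> M n" by (simp add: M_def)
  next
    show "M summable_on ?N"
      unfolding M_def
      by (intro summable_on_cmult_right summable_on_subset[OF summable_on_exp_minus_abs_int]) auto
  qed
  hence "continuous_on {1..} (\<lambda>x. \<Sum>\<^sub>\<infinity>n\<in>?N. ?t n x)"
    by (rule uniform_limit_theorem[rotated]) (auto intro!: always_eventually continuous_intros)
  thus ?thesis by (simp add: theta_def[abs_def])
qed

text \<open>Summing the termwise bounds leaves a constant times \<open>exp (- d^2 * x^2)\<close>,
  which beats every power of \<open>x\<close>.\<close>

lemma theta_rapid_decay: "\<exists>C. \<forall>x\<ge>1. norm (theta k a c x) * x ^ j \<le> C"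
proof -
  obtain d where d: "0 < d" "\<And>n::int. of_int n \<noteq> - c \<Longrightarrow> d \<le> \<bar>of_int n + c\<bar>"
    using int_translate_gap[of c] by blast
  let ?N = "{n::int. of_int n \<noteq> - c}"
  define S where "S = (\<Sum>\<^sub>\<infinity>n\<in>?N. exp (- \<bar>real_of_int n\<bar>))"
  define K where "K = fact k * exp (1 + \<bar>c\<bar>) * S"
  have hs: "((\<lambda>n. exp (- \<bar>real_of_int n\<bar>)) has_sum S) ?N"
    unfolding S_def by (intro has_sum_infsum summable_on_subset[OF summable_on_exp_minus_abs_int]) auto
  have "0 \<le> S" unfolding S_def by (intro infsum_nonneg) auto
  hence "0 \<le> K" by (simp add: K_def)
  have "norm (theta k a c x) * x ^ j \<le> K * (fact j / (d\<^sup>2) ^ j)" if x: "1 \<le> x" for x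
  proof -
    let ?t = "\<lambda>n. cis (2 * pi * a * real_of_int n) *
      of_real ((of_int n + c) ^ k * exp (- pi * (of_int n + c)\<^sup>2 * x\<^sup>2))"
    let ?B = "\<lambda>n. fact k * exp (1 + \<bar>c\<bar>) * exp (- d\<^sup>2 * x\<^sup>2) * exp (- \<bar>real_of_int n\<bar>)"
    have le: "norm (?t n) \<le> ?B n" if "n \<in> ?N" for n
      using theta_term_bound[OF d(1) d(2)[of n] x, of k] that by (simp add: norm_mult del: of_real_mult)
    have hsB: "(?B has_sum fact k * exp (1 + \<bar>c\<bar>) * exp (- d\<^sup>2 * x\<^sup>2) * S) ?N"
      by (intro has_sum_cmult_right hs)
    have "(\<lambda>n. norm (?t n)) summable_on ?N"
      by (rule Infinite_Sum.abs_summable_on_comparison_test'[OF has_sum_imp_summable[OF hsB] le])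
    hence "(?t has_sum theta k a c x) ?N"
      unfolding theta_def by (rule has_sum_infsum[OF abs_summable_summable])
    hence "norm (theta k a c x) \<le> fact k * exp (1 + \<bar>c\<bar>) * exp (- d\<^sup>2 * x\<^sup>2) * S"
      by (rule norm_infsum_le[OF _ hsB le])
    also have "\<dots> = K * exp (- d\<^sup>2 * x\<^sup>2)" by (simp add: K_def)
    finally have 1: "norm (theta k a c x) \<le> K * exp (- d\<^sup>2 * x\<^sup>2)" .
    have "(d\<^sup>2 * x\<^sup>2) ^ j \<le> fact j * exp (d\<^sup>2 * x\<^sup>2)" by (rule power_le_fact_mult_exp) simp
    hence "exp (- d\<^sup>2 * x\<^sup>2) * (x\<^sup>2) ^ j \<le> fact j / (d\<^sup>2) ^ j"
      using d by (simp add: exp_minus field_simps)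
    moreover have "x ^ j \<le> (x\<^sup>2) ^ j"
      using x by (intro power_mono) (auto simp: power2_eq_square)
    ultimately have 2: "exp (- d\<^sup>2 * x\<^sup>2) * x ^ j \<le> fact j / (d\<^sup>2) ^ j"
      by (meson exp_ge_zero mult_left_mono order.trans)
    have "norm (theta k a c x) * x ^ j \<le> K * exp (- d\<^sup>2 * x\<^sup>2) * x ^ j"
      using 1 x by (intro mult_right_mono) auto
    also have "\<dots> \<le> K * (fact j / (d\<^sup>2) ^ j)"
      unfolding mult.assoc using 2 \<open>0 \<le> K\<close> by (intro mult_left_mono)
    finally show ?thesis .
  qed
  thus ?thesis by blast
qed

lemma mellin_tail_theta_holomorphic [holomorphic_intros]:
  assumes "g holomorphic_on A"
  shows "(\<lambda>s. mellin_tail (theta k a c) (g s)) holomorphic_on A"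
proof -
  have "mellin_tail (theta k a c) holomorphic_on UNIV"
    by (intro mellin_tail_holomorphic continuous_on_theta theta_rapid_decay)
  from holomorphic_on_compose_gen[OF assms this] show ?thesis by (simp add: o_def)
qed

section \<open>Quasi-periodicity and parity of the theta series\<close>

lemma theta_add_one_left: "theta k (a + 1) c = theta k a c"
proof
  have "cis (2 * pi * (a + 1) * of_int n) = cis (2 * pi * a * of_int n)" for n :: int
    using cis_multiple_2pi[of "of_int n"] by (simp add: distrib_left distrib_right flip: cis_mult)
  thus "theta k (a + 1) c x = theta k a c x" for x by (simp add: theta_def)
qed

text \<open>Shifting the summation index by one moves the increment of \<open>c\<close> into the
  phase.\<close>

lemma theta_add_one_right: "theta k a (c + 1) = (\<lambda>x. cis (- 2 * pi * a) * theta k a c x)"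
proof
  fix x
  have "theta k a (c + 1) x = (\<Sum>\<^sub>\<infinity>n\<in>{n::int. of_int n \<noteq> - c}. cis (- 2 * pi * a) *
     (cis (2 * pi * a * of_int n) *
      of_real ((of_int n + c) ^ k * exp (- pi * (of_int n + c)\<^sup>2 * x\<^sup>2))))"
    unfolding theta_def
  proof (rule infsum_reindex_bij_witness[of _ "\<lambda>n. n - 1" "\<lambda>n. n + 1"])
    fix n :: int
    have "cis (2 * pi * a * of_int n) = cis (- 2 * pi * a) * cis (2 * pi * a * of_int (n + 1))"
      by (simp add: cis_mult algebra_simps)
    moreover have "of_int (n + 1) + c = of_int n + (c + 1)" by simp
    ultimately show "cis (- 2 * pi * a) * (cis (2 * pi * a * of_int (n + 1)) *
        of_real ((of_int (n + 1) + c) ^ k * exp (- pi * (of_int (n + 1) + c)\<^sup>2 * x\<^sup>2))) =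
      cis (2 * pi * a * of_int n) *
        of_real ((of_int n + (c + 1)) ^ k * exp (- pi * (of_int n + (c + 1))\<^sup>2 * x\<^sup>2))"
      by (simp only: mult.assoc)
  qed auto
  thus "theta k a (c + 1) x = cis (- 2 * pi * a) * theta k a c x"
    by (simp only: infsum_cmult_right' theta_def)
qed

text \<open>Replacing \<open>n\<close> by \<open>-n\<close> restores phase and Gaussian and negates
  the factor \<open>n + c\<close>.\<close>

lemma theta_uminus: "theta k (- a) (- c) = (\<lambda>x. (- 1) ^ k * theta k a c x)"
proof
  fix x
  have "theta k (- a) (- c) x = (\<Sum>\<^sub>\<infinity>n\<in>{n::int. of_int n \<noteq> - c}. (- 1) ^ k *
     (cis (2 * pi * a * of_int n) *
      of_real ((of_int n + c) ^ k * exp (- pi * (of_int n + c)\<^sup>2 * x\<^sup>2))))"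
    unfolding theta_def
  proof (rule infsum_reindex_bij_witness[of _ uminus uminus])
    fix n :: int
    have "of_int (- n) + c = - (of_int n + - c)" by simp
    thus "(- 1) ^ k * (cis (2 * pi * a * of_int (- n)) *
        of_real ((of_int (- n) + c) ^ k * exp (- pi * (of_int (- n) + c)\<^sup>2 * x\<^sup>2))) =
      cis (2 * pi * - a * of_int n) *
        of_real ((of_int n + - c) ^ k * exp (- pi * (of_int n + - c)\<^sup>2 * x\<^sup>2))"
      by (simp only: power_minus[of "of_int n + - c" k] power2_minus) simp
  qed (auto simp: minus_equation_iff)
  thus "theta k (- a) (- c) x = (- 1) ^ k * theta k a c x"
    by (simp only: infsum_cmult_right' theta_def)
qed

section \<open>Symmetries of the completed functions\<close>

lemma exp_eq_cis:
  "exp (2 * of_real pi * \<i> * of_real x * of_real y) = cis (2 * pi * x * y)"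
  by (simp add: cis_conv_exp mult_ac)

text \<open>The second series in the definitions has a phase in \<open>n - a\<close>, whereas
  \<open>theta\<close> has one in \<open>n\<close>. The constant between them becomes the prefactor
  in \<open>Lambda_entire\<close>.\<close>

lemma cis_shift: "cis (2 * pi * c * (n - a)) = cis (- 2 * pi * a * c) * cis (2 * pi * c * n)"
  by (simp add: cis_mult algebra_simps)

text \<open>The common shape of \<^const>\<open>Lambda_plus\<close> without its polar part (\<open>k = 0\<close>) and
  of \<^const>\<open>Lambda_minus\<close> (\<open>k = 1\<close>).\<close>

definition Lambda_entire :: "nat \<Rightarrow> complex \<Rightarrow> real \<Rightarrow> real \<Rightarrow> complex" where
  "Lambda_entire k s a c =
     2 * mellin_tail (theta k a c) (s - 1 + of_nat k)
   + 2 * (- \<i>) ^ k * cis (- 2 * pi * a * c) * mellin_tail (theta k c (- a)) (of_nat k - s)"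

lemma Lambda_plus_eq:
  "Lambda_plus s a c = Lambda_entire 0 s a c
     + 2 * delta_int a / (s - 1) - 2 * delta_int c * cis (- 2 * pi * a * c) / s"
proof -
  have 1: "(\<Sum>\<^sub>\<infinity>n\<in>{n::int. of_int n \<noteq> - c}.
       exp (2 * of_real pi * \<i> * of_real a * of_int n) *
       of_real (exp (- pi * (of_int n + c)\<^sup>2 * x\<^sup>2))) = theta 0 a c x" for x
    unfolding theta_def by (intro infsum_cong) (simp add: cis_conv_exp mult_ac)
  have 2: "(\<Sum>\<^sub>\<infinity>n\<in>{n::int. of_int n \<noteq> a}.
       exp (2 * of_real pi * \<i> * of_real c * of_real (of_int n - a)) *
       of_real (exp (- pi * (of_int n - a)\<^sup>2 * x\<^sup>2))) =
     cis (- 2 * pi * a * c) * theta 0 c (- a) x" for x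
    unfolding theta_def infsum_cmult_right'[symmetric]
    by (intro infsum_cong_neutral) (auto simp: exp_eq_cis cis_shift simp del: of_real_diff)
  have 3: "exp (- 2 * of_real pi * \<i> * of_real a * of_real c) = cis (- 2 * pi * a * c)"
    by (simp add: cis_conv_exp mult_ac)
  show ?thesis
    unfolding Lambda_plus_def 1 2 3
    by (simp add: Lambda_entire_def mellin_tail_def mult.assoc)
qed

text \<open>The defining sums run over all integers; a term missing from \<open>theta 1\<close>
  vanishes through its factor \<open>n + c\<close> or \<open>n - a\<close>.\<close>

lemma Lambda_minus_eq: "Lambda_minus s a c = Lambda_entire 1 s a c"
proof -
  have 1: "(\<Sum>\<^sub>\<infinity>n\<in>(UNIV::int set).
       exp (2 * of_real pi * \<i> * of_real a * of_int n) *
       of_real ((of_int n + c) * exp (- pi * (of_int n + c)\<^sup>2 * x\<^sup>2))) = theta 1 a c x" for x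
    unfolding theta_def by (intro infsum_cong_neutral) (auto simp: cis_conv_exp mult_ac)
  have 2: "(\<Sum>\<^sub>\<infinity>n\<in>(UNIV::int set).
       exp (2 * of_real pi * \<i> * of_real c * of_real (of_int n - a)) *
       of_real ((of_int n - a) * exp (- pi * (of_int n - a)\<^sup>2 * x\<^sup>2))) =
     cis (- 2 * pi * a * c) * theta 1 c (- a) x" for x
    unfolding theta_def infsum_cmult_right'[symmetric]
    by (intro infsum_cong_neutral) (auto simp: exp_eq_cis cis_shift simp del: of_real_diff)
  show ?thesis
    unfolding Lambda_minus_def 1 2
    by (simp add: Lambda_entire_def mellin_tail_def mult.assoc)
qed

text \<open>The first theta series is periodic in \<open>a\<close>. The second gains
  \<open>cis (2 * pi * c)\<close>, which the change of the prefactor cancels.\<close>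

lemma Lambda_entire_add_one_left: "Lambda_entire k s (a + 1) c = Lambda_entire k s a c"
proof -
  have "theta k c (- a) = (\<lambda>x. cis (- 2 * pi * c) * theta k c (- a - 1) x)"
    using theta_add_one_right[of k c "- a - 1"] by simp
  hence "mellin_tail (theta k c (- a)) z = cis (- 2 * pi * c) * mellin_tail (theta k c (- a - 1)) z" for z
    by (simp add: mellin_tail_cmult)
  moreover have "cis (- 2 * pi * (a + 1) * c) = cis (- 2 * pi * a * c) * cis (- 2 * pi * c)"
    by (simp add: cis_mult algebra_simps)
  ultimately show ?thesis
    by (simp add: Lambda_entire_def theta_add_one_left)
qed

text \<open>The first theta series gains the multiplier by quasi-periodicity; in the second summand
  it comes from the prefactor.\<close>

lemma Lambda_entire_add_one_right:
  "Lambda_entire k s a (c + 1) = cis (- 2 * pi * a) * Lambda_entire k s a c"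
proof -
  have "cis (- 2 * pi * a * (c + 1)) = cis (- 2 * pi * a) * cis (- 2 * pi * a * c)"
    by (simp add: cis_mult algebra_simps)
  thus ?thesis
    by (simp add: Lambda_entire_def theta_add_one_left theta_add_one_right mellin_tail_cmult
        distrib_left)
qed

lemma Lambda_entire_uminus: "Lambda_entire k s (- a) (- c) = (- 1) ^ k * Lambda_entire k s a c"
  using theta_uminus[of k c "- a"]
  by (simp add: Lambda_entire_def theta_uminus mellin_tail_cmult distrib_left)

text \<open>The map \<open>s -> 1 - s\<close> swaps the exponents \<open>s - 1 + k\<close> and
  \<open>k - s\<close>, and passing to \<open>(-c, a)\<close> swaps the two theta series up to
  parity, so the two summands trade places.\<close>

lemma Lambda_entire_one_minus:
  "Lambda_entire k (1 - s) a c = \<i> ^ k * cis (- 2 * pi * a * c) * Lambda_entire k s (- c) a"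
proof -
  have *: "theta k (- c) a = (\<lambda>x. (- 1) ^ k * theta k c (- a) x)"
    using theta_uminus[of k c "- a"] by simp
  have i: "\<i> ^ k * (- \<i>) ^ k = 1" "\<i> ^ k * (- 1) ^ k = (- \<i>) ^ k"
    by (simp_all flip: power_mult_distrib)
  have cis: "cis (2 * pi * a * c) * cis (- 2 * pi * a * c) = 1" by (simp add: cis_mult)
  \<comment> \<open>Here \<open>p\<close>, \<open>q\<close>, \<open>m\<close> are the
    \<open>k\<close>-th powers of \<open>\<i>\<close>, \<open>-\<i>\<close>, \<open>-1\<close>;
    \<open>u\<close> and \<open>v\<close> are the inverse phases; \<open>A\<close> and
    \<open>B\<close> are the transforms of the theta series at \<open>(a, c)\<close> and
    \<open>(c, -a)\<close>.\<close>
  have arith: "p * u * (2 * (m * B) + 2 * q * v * A) = 2 * A + 2 * q * u * B"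
    if "p * q = 1" "p * m = q" "v * u = 1" for p q m u v A B :: complex
    using that by algebra
  have "- 2 * pi * - c * a = 2 * pi * a * c" "1 - s - 1 + of_nat k = of_nat k - s"
       "of_nat k - (1 - s) = s - 1 + of_nat k"
    by simp_all
  thus ?thesis
    unfolding Lambda_entire_def * mellin_tail_cmult
    by (simp only: arith[OF i cis] minus_minus)
qed

section \<open>Reflection and functional equation with polar terms\<close>

lemma delta_int_one_minus: "delta_int (1 - x) = delta_int x"
  using Ints_diff[OF Ints_1, of x] Ints_diff[OF Ints_1, of "1 - x"] by (auto simp: delta_int_def)

text \<open>The phase is 1 wherever the indicator is nonzero, so polar terms may absorb or release
  such phases.\<close>

lemma delta_int_mult_cis: "delta_int x * cis (- 2 * pi * x) = delta_int x"
proof (cases "x \<in> \<int>")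
  case True
  hence "cis (2 * pi * - x) = 1" by (intro cis_multiple_2pi) simp
  thus ?thesis by simp
qed (simp add: delta_int_def)

lemma Lambda_entire_one_minus_left: "Lambda_entire k s (1 - a) c = Lambda_entire k s (- a) c"
  using Lambda_entire_add_one_left[of k s "- a" c] by (simp add: add.commute)

text \<open>Shift the second argument by one, apply parity, then shift the first argument by
  one.\<close>

lemma Lambda_entire_reflect:
  "cis (2 * pi * c) * Lambda_entire k s c (1 - a) = (- 1) ^ k * Lambda_entire k s (1 - c) a"
proof -
  have "cis (2 * pi * c) * Lambda_entire k s c (1 - a)
      = (cis (2 * pi * c) * cis (- 2 * pi * c)) * Lambda_entire k s c (- a)"
    using Lambda_entire_add_one_right[of k s c "- a"] by (simp add: add.commute)
  also have "\<dots> = Lambda_entire k s (- (- c)) (- a)" by (simp add: cis_mult)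
  also have "\<dots> = (- 1) ^ k * Lambda_entire k s (1 - c) a"
    unfolding Lambda_entire_uminus Lambda_entire_one_minus_left ..
  finally show ?thesis .
qed

lemma Lambda_plus_reflect: "cis (2 * pi * c) * Lambda_plus s c (1 - a) = Lambda_plus s (1 - c) a"
proof -
  have "delta_int c * cis (2 * pi * c) = delta_int c"
    by (simp add: delta_int_def cis_multiple_2pi)
  moreover have "delta_int a * (cis (2 * pi * c) * cis (- 2 * pi * c * (1 - a)))
      = delta_int a * cis (- 2 * pi * (1 - c) * a)"
  proof -
    \<comment> \<open>The phase inserted here is free because of \<open>delta_int a\<close>, and
      turns \<open>cis (2 * pi * a * c)\<close> into the phase required.\<close>
    have "delta_int a * (cis (2 * pi * c) * cis (- 2 * pi * c * (1 - a)))
      = (delta_int a * cis (- 2 * pi * a)) * (cis (2 * pi * c) * cis (- 2 * pi * c * (1 - a)))"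
      by (simp only: delta_int_mult_cis)
    also have "\<dots> = delta_int a * cis (- 2 * pi * (1 - c) * a)"
      by (simp add: cis_mult algebra_simps)
    finally show ?thesis .
  qed
  moreover have "cis (2 * pi * c) * Lambda_plus s c (1 - a) =
      cis (2 * pi * c) * Lambda_entire 0 s c (1 - a)
      + 2 * (delta_int c * cis (2 * pi * c)) / (s - 1)
      - 2 * (delta_int a * (cis (2 * pi * c) * cis (- 2 * pi * c * (1 - a)))) / s"
    by (simp add: Lambda_plus_eq delta_int_one_minus distrib_left right_diff_distrib mult_ac
        del: mult_minus_left mult_minus_right)
  ultimately show ?thesis
    by (simp only: Lambda_plus_eq Lambda_entire_reflect delta_int_one_minus) simp
qed

lemma Lambda_minus_reflect: "cis (2 * pi * c) * Lambda_minus s c (1 - a) = - Lambda_minus s (1 - c) a"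
  by (simp add: Lambda_minus_eq Lambda_entire_reflect)

text \<open>The entire parts are already matched; \<open>s -> 1 - s\<close> exchanges the poles 0
  and 1, hence the two polar terms. At \<open>s = 0\<close> and \<open>s = 1\<close> the equation
  persists under \<open>x / 0 = 0\<close>.\<close>

lemma Lambda_plus_functional_equation:
  "Lambda_plus (1 - s) a c = cis (- 2 * pi * a * c) * Lambda_plus s (1 - c) a"
proof -
  have "cis (- 2 * pi * a * c) * cis (- 2 * pi * (1 - c) * a) = cis (- 2 * pi * a)"
    by (simp add: cis_mult algebra_simps)
  hence "cis (- 2 * pi * a * c) * (delta_int a * cis (- 2 * pi * (1 - c) * a)) = delta_int a"
    by (simp only: mult.left_commute[of "cis _" "delta_int a"] delta_int_mult_cis)
  moreover have "cis (- 2 * pi * a * c) * Lambda_plus s (1 - c) a =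
      cis (- 2 * pi * a * c) * Lambda_entire 0 s (- c) a
      + 2 * delta_int c * cis (- 2 * pi * a * c) / (s - 1)
      - 2 * (cis (- 2 * pi * a * c) * (delta_int a * cis (- 2 * pi * (1 - c) * a))) / s"
    by (simp add: Lambda_plus_eq Lambda_entire_one_minus_left delta_int_one_minus
        distrib_left right_diff_distrib mult_ac del: mult_minus_left mult_minus_right)
  moreover have "x / (1 - s) = - (x / (s - 1))" for x
    using minus_divide_right[of x "s - 1"] by simp
  ultimately show ?thesis
    by (simp add: Lambda_plus_eq Lambda_entire_one_minus)
qed

lemma Lambda_minus_functional_equation:
  "Lambda_minus (1 - s) a c = \<i> * cis (- 2 * pi * a * c) * Lambda_minus s (1 - c) a"
  by (simp add: Lambda_minus_eq Lambda_entire_one_minus Lambda_entire_one_minus_left)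

lemma Lambda_entire_holomorphic [holomorphic_intros]:
  "(\<lambda>s. Lambda_entire k s a c) holomorphic_on A"
  unfolding Lambda_entire_def by (intro holomorphic_intros)

section \<open>The functional equation\<close>

text \<open>\<open>rGamma\<close> is entire, which makes the Gamma factors holomorphic. The
  rewriting is valid even at the poles of \<open>Gamma\<close>, where both sides are 0 by the
  conventions for \<open>Gamma\<close> and division.\<close>

lemma zeta_star_rGamma:
  "zeta_star s a c = remove_sings (\<lambda>z.
     1 / 2 * (of_real pi powr (z / 2) * rGamma (z / 2) * Lambda_plus z a c
            + of_real pi powr ((z + 1) / 2) * rGamma ((z + 1) / 2) * Lambda_minus z a c)) s"
proof -
  have "x / Gamma z = x * rGamma z" for x z :: complex
    by (simp only: rGamma_inverse_Gamma divide_inverse)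
  thus ?thesis by (simp only: zeta_star_def)
qed

text \<open>Away from 0 and 1 the formula is analytic, so \<open>remove_sings\<close> returns its
  value.\<close>

lemma zeta_star_eq:
  assumes "s \<noteq> 0" "s \<noteq> 1"
  shows "zeta_star s a c =
     1 / 2 * (of_real pi powr (s / 2) * rGamma (s / 2) * Lambda_plus s a c
            + of_real pi powr ((s + 1) / 2) * rGamma ((s + 1) / 2) * Lambda_minus s a c)"
  unfolding zeta_star_rGamma
proof (rule remove_sings_at_analytic)
  have "(\<lambda>z. 1 / 2 * (of_real pi powr (z / 2) * rGamma (z / 2) * Lambda_plus z a c
            + of_real pi powr ((z + 1) / 2) * rGamma ((z + 1) / 2) * Lambda_minus z a c))
        holomorphic_on - {0, 1}"
    unfolding Lambda_plus_eq Lambda_minus_eq by (intro holomorphic_intros) auto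
  moreover have "open (- {0, 1 :: complex})" by (intro open_Compl finite_imp_closed) auto
  ultimately show "(\<lambda>z. 1 / 2 * (of_real pi powr (z / 2) * rGamma (z / 2) * Lambda_plus z a c
            + of_real pi powr ((z + 1) / 2) * rGamma ((z + 1) / 2) * Lambda_minus z a c))
        analytic_on {s}"
    using assms by (subst analytic_at) blast
qed

lemma entire_imp_meromorphic: "f holomorphic_on UNIV \<Longrightarrow> f meromorphic_on UNIV"
  by (simp add: analytic_on_open analytic_on_imp_meromorphic_on)

lemma zeta_star_meromorphic: "(\<lambda>s. zeta_star s a c) meromorphic_on UNIV"
proof -
  have "(\<lambda>z. Lambda_plus z a c) meromorphic_on UNIV"
    unfolding Lambda_plus_eq
    by (intro meromorphic_intros entire_imp_meromorphic[OF Lambda_entire_holomorphic])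
  moreover have "(\<lambda>z. Lambda_minus z a c) meromorphic_on UNIV"
    unfolding Lambda_minus_eq by (rule entire_imp_meromorphic[OF Lambda_entire_holomorphic])
  moreover have "(\<lambda>z. of_real pi powr (z / 2)) meromorphic_on UNIV"
      "(\<lambda>z. rGamma (z / 2)) meromorphic_on UNIV"
      "(\<lambda>z. of_real pi powr ((z + 1) / 2)) meromorphic_on UNIV"
      "(\<lambda>z. rGamma ((z + 1) / 2)) meromorphic_on UNIV"
    by (rule entire_imp_meromorphic, intro holomorphic_intros; simp)+
  ultimately show ?thesis
    unfolding zeta_star_rGamma by (intro meromorphic_intros)
qed

section \<open>Gamma factors and the final identity\<close>

lemma Gamma_meromorphic: "(Gamma :: complex \<Rightarrow> complex) meromorphic_on A"
proof -
  have "(\<lambda>s. inverse (rGamma s)) meromorphic_on A"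
    by (intro meromorphic_intros analytic_on_imp_meromorphic_on analytic_rGamma)
  thus ?thesis by (simp add: rGamma_inverse_Gamma)
qed

text \<open>Duplication writes \<open>Gamma s\<close> through \<open>Gamma (s / 2)\<close> and
  \<open>Gamma ((s + 1) / 2)\<close>; reflection writes cosine and sine as products of two
  \<open>rGamma\<close> values. For non-integral \<open>s\<close> these cancel, leaving the
  left-hand factor.\<close>

lemma gamma_factor_identities:
  fixes s :: complex
  assumes "s \<notin> \<int>"
  defines "G \<equiv> (2 * of_real pi) powr (- s) * Gamma s"
  shows "of_real pi powr ((1 - s) / 2) * rGamma ((1 - s) / 2)
           = 2 * G * cos (of_real pi * s / 2) * (of_real pi powr (s / 2) * rGamma (s / 2))" (is ?even)
    and "of_real pi powr ((1 - s + 1) / 2) * rGamma ((1 - s + 1) / 2)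
           = 2 * G * sin (of_real pi * s / 2)
             * (of_real pi powr ((s + 1) / 2) * rGamma ((s + 1) / 2))" (is ?odd)
proof -
  \<comment> \<open>All powers of \<open>pi\<close> and 2 are written as exponentials of multiples
    of \<open>L\<close> and \<open>l\<close>, so that comparing them is linear arithmetic in
    exponents.\<close>
  define L :: complex where "L = of_real (ln pi)"
  define l :: complex where "l = of_real (ln 2)"
  define u where "u = Gamma (s / 2)"
  define v where "v = Gamma ((s + 1) / 2)"
  \<comment> \<open>If \<open>s / 2\<close> or \<open>(s + 1) / 2\<close> were an integer, these
    equations would make \<open>s\<close> one.\<close>
  have "2 * (s / 2) = s" "2 * ((s + 1) / 2) - 1 = s" by (simp_all add: add_divide_distrib ring_distribs)
  hence "s / 2 \<notin> \<int>" "(s + 1) / 2 \<notin> \<int>"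
    using assms(1) by (metis Ints_1 Ints_diff Ints_mult Ints_numeral)+
  hence nz: "s / 2 \<notin> \<int>\<^sub>\<le>\<^sub>0" "(s + 1) / 2 \<notin> \<int>\<^sub>\<le>\<^sub>0"
    using nonpos_Ints_subset_Ints by blast+
  have uv: "u * rGamma (s / 2) = 1" "v * rGamma ((s + 1) / 2) = 1"
    using nz by (simp_all add: u_def v_def rGamma_inverse_Gamma Gamma_eq_zero_iff)
  have powr_pi: "of_real pi powr z = exp (z * L)" for z
    by (simp add: powr_def L_def Ln_of_real)
  have "Ln (2 * of_real pi) = l + L"
    using Ln_of_real[of "2 * pi"] by (simp add: l_def L_def ln_mult)
  hence powr_2pi: "(2 * of_real pi) powr z = exp (z * (l + L))" for z :: complex
    by (simp add: powr_def)
  have exp_L: "of_real pi = exp L" by (simp add: L_def exp_of_real)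
  have exp_l: "2 = exp l" by (simp add: l_def exp_of_real)
  have sqrt: "of_real (sqrt pi) = exp (L / 2)"
  proof -
    have "sqrt pi = exp (ln pi / 2)" using exp_ln[of "sqrt pi"] by (simp add: ln_sqrt)
    thus ?thesis by (simp add: L_def flip: exp_of_real)
  qed
  have "u * v = exp ((1 - s) * l) * exp (L / 2) * Gamma s"
    using Gamma_legendre_duplication[of "s / 2"] nz
    by (simp add: u_def v_def l_def sqrt add_divide_distrib)
  moreover have "exp ((1 - s) * l) * exp (L / 2) * exp ((s - 1) * l - L / 2) = 1"
    by (simp add: algebra_simps flip: exp_add)
  ultimately have "Gamma s = u * v * exp ((s - 1) * l - L / 2)"
    by (simp add: mult_ac)
  hence "2 * G = u * v * (exp l * exp (- s * (l + L)) * exp ((s - 1) * l - L / 2))"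
    by (simp add: G_def powr_2pi flip: exp_l)
  also have "exp l * exp (- s * (l + L)) * exp ((s - 1) * l - L / 2) = exp (- s * L - L / 2)"
    by (simp add: algebra_simps flip: exp_add)
  finally have G: "2 * G = u * v * exp (- s * L - L / 2)" .
  have cos: "cos (of_real pi * s / 2) = exp L * (rGamma ((s + 1) / 2) * rGamma ((1 - s) / 2))"
  proof -
    have "sin (of_real pi * ((s + 1) / 2)) = cos (of_real pi * s / 2)"
      using cos_sin_eq[of "- (of_real pi * s / 2)"] by (simp add: algebra_simps add_divide_distrib)
    moreover have "1 - (s + 1) / 2 = (1 - s) / 2" by (simp add: field_simps)
    ultimately have "rGamma ((s + 1) / 2) * rGamma ((1 - s) / 2) = cos (of_real pi * s / 2) / of_real pi"
      using rGamma_reflection_complex[of "(s + 1) / 2"] by (simp only:)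
    thus ?thesis by (simp flip: exp_L)
  qed
  have sin: "sin (of_real pi * s / 2) = exp L * (rGamma (s / 2) * rGamma ((1 - s + 1) / 2))"
  proof -
    have "1 - s / 2 = (1 - s + 1) / 2" by (simp add: field_simps)
    hence "rGamma (s / 2) * rGamma ((1 - s + 1) / 2) = sin (of_real pi * s / 2) / of_real pi"
      using rGamma_reflection_complex[of "s / 2"] by (simp only: times_divide_eq_right)
    thus ?thesis by (simp flip: exp_L)
  qed
  have "2 * G * cos (of_real pi * s / 2) * (of_real pi powr (s / 2) * rGamma (s / 2))
      = (u * rGamma (s / 2)) * (v * rGamma ((s + 1) / 2)) * rGamma ((1 - s) / 2)
        * (exp (- s * L - L / 2) * exp L * exp (s / 2 * L))"
    unfolding G cos powr_pi by (simp only: mult_ac)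
  also have "exp (- s * L - L / 2) * exp L * exp (s / 2 * L) = exp ((1 - s) / 2 * L)"
    by (simp add: field_simps flip: exp_add)
  finally show ?even by (simp add: uv powr_pi)
  have "2 * G * sin (of_real pi * s / 2) * (of_real pi powr ((s + 1) / 2) * rGamma ((s + 1) / 2))
      = (u * rGamma (s / 2)) * (v * rGamma ((s + 1) / 2)) * rGamma ((1 - s + 1) / 2)
        * (exp (- s * L - L / 2) * exp L * exp ((s + 1) / 2 * L))"
    unfolding G sin powr_pi by (simp only: mult_ac)
  also have "exp (- s * L - L / 2) * exp L * exp ((s + 1) / 2 * L) = exp ((1 - s + 1) / 2 * L)"
    unfolding exp_add[symmetric] by (rule arg_cong[of _ _ exp]) (simp add: field_simps)
  finally show ?odd by (simp add: uv powr_pi)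
qed

text \<open>Off the integers \<open>zeta_star\<close> is given by its formula at \<open>s\<close>
  and \<open>1 - s\<close>, and the Gamma identities apply, so the claim is pointwise
  algebra.\<close>

lemma zeta_star_functional_equation:
  assumes "s \<notin> \<int>"
  shows "zeta_star (1 - s) a c = (2 * of_real pi) powr (- s) * Gamma s *
       (exp (of_real pi * \<i> * s / 2) * exp (- 2 * of_real pi * \<i> * of_real a * of_real c)
          * zeta_star s (1 - c) a
      + exp (- of_real pi * \<i> * s / 2) * exp (2 * of_real pi * \<i> * of_real c * of_real (1 - a))
          * zeta_star s c (1 - a))"
proof -
  define G where "G = (2 * of_real pi) powr (- s) * Gamma s"
  define E where "E = cis (- 2 * pi * a * c)"
  define W where "W = cis (2 * pi * c)"
  define P where "P = of_real pi powr (s / 2) * rGamma (s / 2)"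
  define Q where "Q = of_real pi powr ((s + 1) / 2) * rGamma ((s + 1) / 2)"
  have s: "s \<noteq> 0" "s \<noteq> 1" "1 - s \<noteq> 0" "1 - s \<noteq> 1" using assms by auto
  have e1: "exp (of_real pi * \<i> * s / 2) = cos (of_real pi * s / 2) + \<i> * sin (of_real pi * s / 2)"
    using exp_Euler[of "of_real pi * s / 2"] by (simp add: mult_ac)
  have e2: "exp (- of_real pi * \<i> * s / 2) = cos (of_real pi * s / 2) - \<i> * sin (of_real pi * s / 2)"
    using exp_minus_Euler[of "of_real pi * s / 2"] by (simp add: mult_ac)
  have e3: "exp (- 2 * of_real pi * \<i> * of_real a * of_real c) = E"
    by (simp add: E_def cis_conv_exp mult_ac)
  have e4: "exp (2 * of_real pi * \<i> * of_real c * of_real (1 - a)) = E * W"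
    unfolding exp_eq_cis by (simp add: E_def W_def cis_mult algebra_simps)
  \<comment> \<open>\<open>x\<close> and \<open>y\<close> stand for cosine and sine,
    \<open>A\<close> and \<open>B\<close> for \<open>Lambda_plus\<close> and
    \<open>Lambda_minus\<close> at \<open>(1 - c, a)\<close>, \<open>A'\<close> and
    \<open>B'\<close> for those at \<open>(c, 1 - a)\<close>. The opposite reflection signs leave
    \<open>x\<close> with \<open>A\<close> and \<open>\<i> * y\<close> with
    \<open>B\<close>.\<close>
  have arith: "1 / 2 * (2 * G * x * P * (E * A) + 2 * G * y * Q * (\<i> * E * B)) =
      G * ((x + \<i> * y) * E * (1 / 2 * (P * A + Q * B))
         + (x - \<i> * y) * (E * W) * (1 / 2 * (P * A' + Q * B')))"
    if "W * A' = A" "W * B' = - B" for x y A B A' B'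
  proof -
    have "W * (P * A' + Q * B') = P * (W * A') + Q * (W * B')"
      by (simp add: algebra_simps)
    also have "\<dots> = P * A - Q * B" by (simp add: that)
    finally have "W * (P * A' + Q * B') = P * A - Q * B" .
    hence "(x - \<i> * y) * (E * W) * (1 / 2 * (P * A' + Q * B'))
        = (x - \<i> * y) * E * (1 / 2 * (P * A - Q * B))"
      by (simp add: mult.assoc mult.left_commute)
    thus ?thesis by (simp only:) (simp add: field_simps)
  qed
  show ?thesis
    unfolding e1 e2 e3 e4 zeta_star_eq[OF s(1,2)] zeta_star_eq[OF s(3,4)]
      gamma_factor_identities[OF assms] Lambda_plus_functional_equation
      Lambda_minus_functional_equation
    unfolding G_def[symmetric] P_def[symmetric] Q_def[symmetric] E_def[symmetric]
    by (rule arith) (simp_all add: W_def Lambda_plus_reflect Lambda_minus_reflect)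
qed

theorem theorem5p4:
  fixes a c :: real
  shows "meromorphic_identity
    (\<lambda>s. zeta_star (1 - s) a c)
    (\<lambda>s. (2 * of_real pi) powr (- s) * Gamma s *
       (exp (of_real pi * \<i> * s / 2) * exp (- 2 * of_real pi * \<i> * of_real a * of_real c)
          * zeta_star s (1 - c) a
      + exp (- of_real pi * \<i> * s / 2) * exp (2 * of_real pi * \<i> * of_real c * of_real (1 - a))
          * zeta_star s c (1 - a)))"
  (is "meromorphic_identity ?f ?g")
proof -
  have "(\<lambda>s. (2 * of_real pi) powr (- s)) meromorphic_on UNIV"
    "(\<lambda>s. exp (of_real pi * \<i> * s / 2)) meromorphic_on UNIV"
    "(\<lambda>s. exp (- of_real pi * \<i> * s / 2)) meromorphic_on UNIV"
    by (rule entire_imp_meromorphic, intro holomorphic_intros; simp)+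
  hence g: "?g meromorphic_on UNIV"
    by (intro meromorphic_intros zeta_star_meromorphic Gamma_meromorphic)
  have eq: "\<forall>\<^sub>F s in at z. ?f s = ?g s" for z
  proof -
    \<comment> \<open>The integers other than \<open>z\<close> form a closed set, so the pointwise
      identity holds on a punctured neighbourhood of every \<open>z\<close>, integral or
      not.\<close>
    have "open (- (\<int> - {z}))" by (intro open_Compl closed_subset_Ints) auto
    hence "\<forall>\<^sub>F s in at z. s \<in> - (\<int> - {z}) - {z}" by (intro eventually_at_in_open) auto
    thus ?thesis
    proof eventually_elim
      case (elim s)
      hence "s \<notin> \<int>" by auto
      thus ?case by (rule zeta_star_functional_equation)
    qed
  qed
  \<comment> \<open>Agreement near every point transfers meromorphy from the right-hand side,
    avoiding the composition with \<open>1 - s\<close>.\<close>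
  have "?f meromorphic_on UNIV"
    using g meromorphic_on_cong[OF eq refl] by blast
  moreover have "remove_sings ?f = remove_sings ?g"
    by (intro ext remove_sings_cong[OF eq refl])
  ultimately show ?thesis
    using g by (simp add: meromorphic_identity_def)
qed

end
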